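(* Let $m$ be a positive integer, let $n\in\{2,4,6,\ldots\}$, and let $i=\sqrt{-1}$. Then $$\sum_{\substack{0\le k\le n\\ 4\mid k-2}}\binom nk(-1)^{\frac{k-2}4}2^{n-\frac k2}m^kB_{n-k}=\frac n2\Big\{m^{n-1}\Big((-1)^{\lfloor\frac{n-2}4\rfloor}2^{\frac n2}-(1+(-1)^m)(-1)^{\frac n2}\Big)+2i\sum_{r=1}^{\lfloor\frac{m-1}2\rfloor}\Big((2r-m-mi)^{n-1}-(2r-m+mi)^{n-1}\Big)\Big\}.$$
   Context: The Bernoulli numbers $B_n$ are defined by $B_0=1$ and $\sum_{k=0}^{n-1}\binom nkB_k=0$ for $n\ge 2$. $\lfloor y\rfloor$ denotes the greatest integer not exceeding $y$. *)

theory Defs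
  imports Complex_Main
begin

(* The recurrence (SUM k<n. (n choose k) * B k) = 0 for n >= 2, solved for its last
   term B (n - 1), whose coefficient is (n choose (n - 1)) = n; below, n is called
   Suc (Suc n). In particular, B 1 = -1/2. *)
fun bernoulli :: "nat \<Rightarrow> real" where
  "bernoulli 0 = 1"
| "bernoulli (Suc n) =
     - (\<Sum>k\<le>n. real (Suc (Suc n) choose k) * bernoulli k) / real (Suc (Suc n))"

lemma bernoulli_recurrence:
  assumes "n \<ge> 2"
  shows "(\<Sum>k<n. real (n choose k) * bernoulli k) = 0"
proof -
  obtain j where n: "n = Suc (Suc j)"
    using assms by (metis add_2_eq_Suc le_Suc_ex)
  have "Suc (Suc j) choose Suc j = Suc (Suc j)"
    using binomial_Suc_n by blast
  then show ?thesis
    unfolding n by (simp add: lessThan_Suc_atMost[symmetric] del: binomial_Suc_Suc of_nat_Suc)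
qed

lemma bernoulli_unique:
  fixes B :: "nat \<Rightarrow> real"
  assumes "B 0 = 1" and rec: "\<And>n. n \<ge> 2 \<Longrightarrow> (\<Sum>k<n. real (n choose k) * B k) = 0"
  shows "B = bernoulli"
proof
  fix n show "B n = bernoulli n"
  proof (induction n rule: less_induct)
    case (less n)
    show ?case
    proof (cases n)
      case 0
      then show ?thesis using assms(1) by simp
    next
      case (Suc j)
      have "(\<Sum>k<Suc n. real (Suc n choose k) * B k)
          = (\<Sum>k<Suc n. real (Suc n choose k) * bernoulli k)"
        using rec[of "Suc n"] bernoulli_recurrence[of "Suc n"] Suc by simp
      moreover have "(\<Sum>k<n. real (Suc n choose k) * B k)
          = (\<Sum>k<n. real (Suc n choose k) * bernoulli k)"
        using less by (intro sum.cong) auto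
      moreover have "Suc n choose n = Suc n"
        using binomial_Suc_n by blast
      ultimately show ?thesis
        by (simp del: binomial_Suc_Suc of_nat_Suc bernoulli.simps)
    qed
  qed
qed

end

theory Submission
  imports Defs "HOL-Computational_Algebra.Polynomial"
begin

text \<open>
  Writing B_n(x) for the Bernoulli polynomial and z = m (1 + i) / 2, w = m (1 - i) / 2, the
  left-hand side is 2^n / (2 i) times E(z) - E(w), where E is the even part of B_n: the
  powers (1 + i)^k and (1 - i)^k with k even agree if 4 divides k and are opposite otherwise.
  The reflection B_n(1 - x) = B_n(x) gives E(x) = B_n(x) + n / 2 x^(n - 1), and since
  z - m = - w, the difference equation of B_n telescopes from z down to - w. Pairing
  the terms j and m - j of the resulting sum leaves a middle term exactly when m is even.
\<close>

section \<open>Bernoulli polynomials: difference equation, reflection, even part\<close>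

definition bernpoly :: "nat \<Rightarrow> complex \<Rightarrow> complex" where
  "bernpoly n x = (\<Sum>k\<le>n. of_nat (n choose k) * of_real (bernoulli (n - k)) * x ^ k)"

lemma bernpoly_0: "bernpoly n 0 = of_real (bernoulli n)"
  unfolding bernpoly_def by (subst sum.remove[of _ 0]) (auto intro!: sum.neutral)

text \<open>Reversing the sum turns it into the defining recurrence plus its missing top term. The
  recurrence starts at 2, so for \<open>n = 1\<close> the lower sum is
  \<open>bernoulli 0 = 1\<close> instead of 0; this exception is the source of the difference
  equation.\<close>

lemma bernpoly_1:
  "bernpoly n 1 = of_real (bernoulli n) + (if n = 1 then 1 else 0)"
proof -
  have "bernpoly n 1 = (\<Sum>k\<le>n. of_nat (n choose k) * of_real (bernoulli k))"
    unfolding bernpoly_def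
    by (rule sum.reindex_bij_witness[of _ "\<lambda>k. n - k" "\<lambda>k. n - k"])
       (auto simp: binomial_symmetric[symmetric])
  also have "\<dots> = of_real (\<Sum>k<n. real (n choose k) * bernoulli k) + of_real (bernoulli n)"
    by (simp add: lessThan_Suc_atMost[symmetric])
  also have "(\<Sum>k<n. real (n choose k) * bernoulli k) = (if n = 1 then 1 else 0)"
    using bernoulli_recurrence[of n] by (cases "n \<ge> 2") (auto simp: not_le less_2_cases_iff)
  finally show ?thesis by simp
qed

text \<open>Taylor expansion about 1: expand \<open>(x + 1) ^ k\<close>, swap the sums, and regroup
  the product of two binomials by \<open>choose_mult\<close>.\<close>

lemma bernpoly_add_1:
  "bernpoly n (x + 1) = (\<Sum>j\<le>n. of_nat (n choose j) * x ^ j * bernpoly (n - j) 1)"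
proof -
  have "bernpoly n (x + 1) = (\<Sum>k\<le>n. \<Sum>j\<le>n. of_nat ((n choose k) * (k choose j)) *
          of_real (bernoulli (n - k)) * x ^ j)"
    unfolding bernpoly_def
  proof (rule sum.cong[OF refl])
    fix k assume k: "k \<in> {..n}"
    have "(x + 1) ^ k = (\<Sum>j\<le>k. of_nat (k choose j) * x ^ j)"
      by (simp add: binomial_ring)
    also have "\<dots> = (\<Sum>j\<le>n. of_nat (k choose j) * x ^ j)"
      using k by (intro sum.mono_neutral_left) auto
    finally show "of_nat (n choose k) * of_real (bernoulli (n - k)) * (x + 1) ^ k =
        (\<Sum>j\<le>n. of_nat ((n choose k) * (k choose j)) * of_real (bernoulli (n - k)) * x ^ j)"
      by (simp add: sum_distrib_left mult_ac)
  qed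
  also have "\<dots> = (\<Sum>j\<le>n. \<Sum>k\<le>n. of_nat ((n choose k) * (k choose j)) *
          of_real (bernoulli (n - k)) * x ^ j)"
    by (rule sum.swap)
  also have "\<dots> = (\<Sum>j\<le>n. of_nat (n choose j) * x ^ j * bernpoly (n - j) 1)"
  proof (rule sum.cong[OF refl])
    fix j assume j: "j \<in> {..n}"
    have "(\<Sum>k\<le>n. of_nat ((n choose k) * (k choose j)) * of_real (bernoulli (n - k)) * x ^ j)
        = (\<Sum>k\<in>{j..n}. of_nat ((n choose k) * (k choose j)) * of_real (bernoulli (n - k)) * x ^ j)"
      by (rule sum.mono_neutral_right) auto
    also have "\<dots> = (\<Sum>k\<le>n - j. of_nat ((n choose j) * ((n - j) choose k)) *
        of_real (bernoulli (n - j - k)) * x ^ j)"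
      by (rule sum.reindex_bij_witness[of _ "\<lambda>k. k + j" "\<lambda>k. k - j"])
         (use j choose_mult in \<open>auto simp: algebra_simps simp flip: of_nat_mult\<close>)
    also have "\<dots> = of_nat (n choose j) * x ^ j * bernpoly (n - j) 1"
      by (simp add: bernpoly_def sum_distrib_left mult_ac)
    finally show "(\<Sum>k\<le>n. of_nat ((n choose k) * (k choose j)) *
        of_real (bernoulli (n - k)) * x ^ j) =
        of_nat (n choose j) * x ^ j * bernpoly (n - j) 1" .
  qed
  finally show ?thesis .
qed

text \<open>By \<open>bernpoly_1\<close> the expansion about 1 has the coefficients of the expansion
  about 0, except in the single term where \<open>n - j = 1\<close>.\<close>

lemma bernpoly_diff:
  assumes "n \<ge> 1"
  shows "bernpoly n (x + 1) = bernpoly n x + of_nat n * x ^ (n - 1)"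
proof -
  have "bernpoly n (x + 1) =
      (\<Sum>j\<le>n. of_nat (n choose j) * of_real (bernoulli (n - j)) * x ^ j
        + (if j = n - 1 then of_nat n * x ^ (n - 1) else 0))"
    unfolding bernpoly_add_1 bernpoly_1
  proof (rule sum.cong[OF refl])
    fix j assume "j \<in> {..n}"
    then have "n - j = 1 \<longleftrightarrow> j = n - 1"
      using assms by auto
    moreover have "n choose (n - 1) = n"
      using assms by (cases n) simp_all
    ultimately show "of_nat (n choose j) * x ^ j *
        (of_real (bernoulli (n - j)) + (if n - j = 1 then 1 else 0)) =
        of_nat (n choose j) * of_real (bernoulli (n - j)) * x ^ j
        + (if j = n - 1 then of_nat n * x ^ (n - 1) else 0)"
      by (auto simp: algebra_simps)
  qed
  also have "\<dots> = bernpoly n x + of_nat n * x ^ (n - 1)"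
    by (simp add: sum.distrib bernpoly_def)
  finally show ?thesis .
qed

lemma bernpoly_diff_of_nat:
  assumes "n \<ge> 1"
  shows "bernpoly n x = bernpoly n (x - of_nat l) + of_nat n * (\<Sum>j=1..l. (x - of_nat j) ^ (n - 1))"
proof (induction l)
  case (Suc l)
  have "bernpoly n (x - of_nat l) =
      bernpoly n (x - of_nat (Suc l)) + of_nat n * (x - of_nat (Suc l)) ^ (n - 1)"
    using bernpoly_diff[OF assms, of "x - of_nat (Suc l)"] by (simp add: algebra_simps)
  with Suc show ?case by (simp add: algebra_simps)
qed simp

text \<open>
  The polynomial B_n(x) - B_n(1 - x) is 1-periodic and vanishes at 0, hence at every
  natural number.
\<close>

lemma bernpoly_reflect:
  assumes "even n" and "n \<ge> 2"
  shows "bernpoly n (1 - x) = bernpoly n x"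
proof -
  \<comment> \<open>A genuine polynomial is needed so that infinitely many roots force it to
    vanish.\<close>
  define P where
    "P = (\<Sum>k\<le>n. monom (of_nat (n choose k) * complex_of_real (bernoulli (n - k))) k)"
  define D where "D = P - pcompose P [:1, -1:]"
  have P: "poly P y = bernpoly n y" for y
    by (simp add: P_def bernpoly_def poly_sum poly_monom)
  have D: "poly D y = bernpoly n y - bernpoly n (1 - y)" for y
    by (simp add: D_def P poly_pcompose)
  have "poly D (of_nat l) = 0" for l
  proof (induction l)
    case 0
    then show ?case using assms by (simp add: D bernpoly_0 bernpoly_1)
  next
    case (Suc l)
    have "bernpoly n (1 - of_nat l) = bernpoly n (- of_nat l) + of_nat n * (- of_nat l) ^ (n - 1)"
      using bernpoly_diff[of n "- of_nat l"] assms by simp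
    \<comment> \<open>As \<open>n - 1\<close> is odd, both Bernoulli values in \<open>D\<close> grow
      by \<open>n * l ^ (n - 1)\<close> from \<open>l\<close> to \<open>Suc l\<close>, and the
      increments cancel.\<close>
    moreover have "(- of_nat l :: complex) ^ (n - 1) = - (of_nat l ^ (n - 1))"
      using assms by simp
    ultimately show ?case
      using Suc bernpoly_diff[of n "of_nat l"] assms by (simp add: D add.commute)
  qed
  then have "range (of_nat :: nat \<Rightarrow> complex) \<subseteq> {y. poly D y = 0}"
    by auto
  moreover have "infinite (range (of_nat :: nat \<Rightarrow> complex))"
    by (simp add: finite_image_iff inj_of_nat)
  ultimately have "D = 0"
    using poly_roots_finite finite_subset by blast
  then show ?thesis using D[of x] by simp
qed

text \<open>Reflection at \<open>x + 1\<close> identifies the left side with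
  \<open>bernpoly n (x + 1)\<close>, to which the difference equation applies.\<close>

lemma bernpoly_uminus:
  assumes "even n" and "n \<ge> 2"
  shows "bernpoly n (- x) = bernpoly n x + of_nat n * x ^ (n - 1)"
  using bernpoly_reflect[OF assms, of "x + 1"] bernpoly_diff[of n x] assms by simp

text \<open>The even part is half of \<open>bernpoly n x + bernpoly n (- x)\<close>, and
  \<open>bernpoly_uminus\<close> removes the second value.\<close>

lemma bernpoly_even_part:
  assumes "even n" and "n \<ge> 2"
  shows "(\<Sum>k | k \<le> n \<and> even k. of_nat (n choose k) * of_real (bernoulli (n - k)) * x ^ k)
       = bernpoly n x + of_nat n / 2 * x ^ (n - 1)"
proof -
  have "bernpoly n x + bernpoly n (- x) =
      (\<Sum>k\<le>n. of_nat (n choose k) * of_real (bernoulli (n - k)) * (x ^ k + (- x) ^ k))"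
    by (simp add: bernpoly_def sum.distrib algebra_simps)
  also have "\<dots> = (\<Sum>k | k \<le> n \<and> even k.
      of_nat (n choose k) * of_real (bernoulli (n - k)) * (x ^ k + (- x) ^ k))"
    by (rule sum.mono_neutral_right) auto
  also have "\<dots> = 2 * (\<Sum>k | k \<le> n \<and> even k.
      of_nat (n choose k) * of_real (bernoulli (n - k)) * x ^ k)"
    unfolding sum_distrib_left by (rule sum.cong) auto
  finally show ?thesis
    using bernpoly_uminus[OF assms, of x] by (simp add: field_simps)
qed

section \<open>Powers of 1 + \<i> and 1 - \<i>\<close>

lemma one_plus_minus_ii_power_even:
  "(1 + \<i>) ^ (2 * j) = 2 ^ j * \<i> ^ j" "(1 - \<i>) ^ (2 * j) = 2 ^ j * (- \<i>) ^ j"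
proof -
  have "(1 + \<i>)\<^sup>2 = 2 * \<i>" "(1 - \<i>)\<^sup>2 = 2 * (- \<i>)"
    by (simp_all add: power2_eq_square algebra_simps)
  then show "(1 + \<i>) ^ (2 * j) = 2 ^ j * \<i> ^ j" "(1 - \<i>) ^ (2 * j) = 2 ^ j * (- \<i>) ^ j"
    by (simp_all only: power_mult power_mult_distrib)
qed

lemma ii_power_even: "\<i> ^ (2 * t) = (- 1) ^ t" "(- \<i>) ^ (2 * t) = (- 1) ^ t"
  by (simp_all add: power_mult)

text \<open>The powers of \<i> and -\<i> agree at even \<open>j\<close> and are opposite at odd
  \<open>j\<close>, which is what filters out the exponents divisible by 4.\<close>

lemma one_plus_minus_ii_diff_even:
  "(1 + \<i>) ^ (2 * j) - (1 - \<i>) ^ (2 * j) =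
     (if odd j then 2 * \<i> * (- 1) ^ (j div 2) * 2 ^ j else 0)"
proof (cases "even j")
  case True
  then show ?thesis by (auto simp: one_plus_minus_ii_power_even)
next
  case False
  then obtain t where t: "j = Suc (2 * t)" by (auto elim!: oddE)
  show ?thesis
    unfolding one_plus_minus_ii_power_even unfolding t power_Suc ii_power_even by simp
qed

text \<open>With \<open>q = Suc p\<close>, one factor 1 + \<i> or 1 - \<i> is left beside an even
  power; for either parity of \<open>p\<close> the difference without \<open>2 ^ p\<close> is 2\<i>
  up to the sign given by \<open>p div 2\<close>.\<close>

lemma one_plus_minus_ii_diff_odd:
  assumes "q \<ge> 1"
  shows "(1 + \<i>) ^ (2 * q - 1) - (1 - \<i>) ^ (2 * q - 1) = \<i> * (- 1) ^ ((q - 1) div 2) * 2 ^ q"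
proof -
  obtain p where p: "q = Suc p" using assms by (cases q) auto
  have e: "2 * q - 1 = Suc (2 * p)" by (simp add: p)
  show ?thesis
  proof (cases "even p")
    case True
    then obtain t where t: "p = 2 * t" by (auto elim!: evenE)
    show ?thesis
      unfolding e power_Suc one_plus_minus_ii_power_even unfolding p t power_Suc ii_power_even
      by (simp add: algebra_simps)
  next
    case False
    then obtain t where t: "p = Suc (2 * t)" by (auto elim!: oddE)
    show ?thesis
      unfolding e power_Suc one_plus_minus_ii_power_even unfolding p t power_Suc ii_power_even
      by (simp add: algebra_simps)
  qed
qed

section \<open>Pairing the terms of a sum under reflection\<close>

text \<open>The involution sending \<open>j\<close> to \<open>m - j\<close> has the fixed point
  \<open>m div 2\<close> for even \<open>m\<close> and none for odd \<open>m\<close>.\<close>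

lemma sum_pair_reflect:
  fixes f :: "nat \<Rightarrow> 'a::comm_monoid_add"
  assumes "m \<ge> 1"
  shows "(\<Sum>j=1..m - 1. f j) =
    (\<Sum>r=1..(m - 1) div 2. f r + f (m - r)) + (if even m then f (m div 2) else 0)"
proof -
  define h where "h = (m - 1) div 2"
  have "{1..m - 1} = {1..h} \<union> ({m - h..m - 1} \<union> (if even m then {m div 2} else {}))"
    using assms by (auto simp: h_def elim!: evenE oddE)
  moreover have "sum f ({1..h} \<union> ({m - h..m - 1} \<union> (if even m then {m div 2} else {}))) =
      sum f {1..h} + (sum f {m - h..m - 1} + sum f (if even m then {m div 2} else {}))"
    using assms by (subst sum.union_disjoint; (subst sum.union_disjoint)?)
      (auto simp: h_def elim!: evenE oddE)
  moreover have "sum f {m - h..m - 1} = (\<Sum>r=1..h. f (m - r))"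
    by (rule sum.reindex_bij_witness[of _ "\<lambda>r. m - r" "\<lambda>r. m - r"])
       (use assms in \<open>auto simp: h_def\<close>)
  ultimately show ?thesis
    by (auto simp: h_def sum.distrib add.assoc)
qed

section \<open>The identity for the lacunary sum\<close>

theorem theorem2p4:
  fixes m n :: nat
  assumes "m \<ge> 1" and "n \<ge> 2" and "even n"
  shows "(\<Sum>k | k \<le> n \<and> (4::int) dvd int k - 2.
            of_nat (n choose k) * (- 1) ^ ((k - 2) div 4) * 2 ^ (n - k div 2) * of_nat m ^ k
              * complex_of_real (bernoulli (n - k)))
       = of_nat n / 2 *
          (of_nat m ^ (n - 1) *
             ((- 1) ^ ((n - 2) div 4) * 2 ^ (n div 2) - (1 + (- 1) ^ m) * (- 1) ^ (n div 2))
           + 2 * \<i> *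
             (\<Sum>r = 1..(m - 1) div 2.
                (2 * of_nat r - of_nat m - of_nat m * \<i>) ^ (n - 1)
                - (2 * of_nat r - of_nat m + of_nat m * \<i>) ^ (n - 1)))"
proof -
  define z w where "z = of_nat m * (1 + \<i>) / 2" and "w = of_nat m * (1 - \<i>) / 2"
  define E where "E x = (\<Sum>k | k \<le> n \<and> even k.
    of_nat (n choose k) * of_real (bernoulli (n - k)) * x ^ k)" for x :: complex
  define S where "S = (\<Sum>r = 1..(m - 1) div 2.
                (2 * of_nat r - of_nat m - of_nat m * \<i>) ^ (n - 1)
                - (2 * of_nat r - of_nat m + of_nat m * \<i>) ^ (n - 1))"
  \<comment> \<open>The unpaired middle term \<open>j = m div 2\<close> of the telescoped sum, after
    scaling by \<open>2 ^ (n - 1)\<close>.\<close>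
  define M :: complex where
    "M = (if even m then \<i> ^ (n - 1) * of_nat m ^ (n - 1) else 0)"
  have npow: "(2::complex) ^ n = 2 * 2 ^ (n - 1)"
    using assms by (simp flip: power_Suc)
  obtain q where q: "n = 2 * q" "q \<ge> 1"
    using assms by (auto elim!: evenE)
  have "(\<Sum>k | k \<le> n \<and> (4::int) dvd int k - 2.
            of_nat (n choose k) * (- 1) ^ ((k - 2) div 4) * 2 ^ (n - k div 2) * of_nat m ^ k
              * complex_of_real (bernoulli (n - k)))
      = (\<Sum>k | k \<le> n \<and> even k.
          2 ^ n / (2 * \<i>) * (of_nat (n choose k) * of_real (bernoulli (n - k)) * z ^ k
            - of_nat (n choose k) * of_real (bernoulli (n - k)) * w ^ k))"
    (is "?L = _")
  proof (rule sum.mono_neutral_cong_left)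
    \<comment> \<open>Contribution of the exponent \<open>2 * j\<close>, with \<open>c\<close>
      standing for the Bernoulli coefficient. It serves both for the terms that vanish
      (\<open>j\<close> even) and for those that survive (\<open>j\<close> odd).\<close>
    have *: "2 ^ n / (2 * \<i>) * (c * z ^ (2 * j) - c * w ^ (2 * j)) =
       (if odd j then c * (- 1) ^ (j div 2) * 2 ^ (n - j) * of_nat m ^ (2 * j) else 0)"
      if "2 * j \<le> n" for j c
    proof -
      have "z ^ (2 * j) - w ^ (2 * j) =
          of_nat m ^ (2 * j) * ((1 + \<i>) ^ (2 * j) - (1 - \<i>) ^ (2 * j)) / 2 ^ (2 * j)"
        unfolding z_def w_def power_divide power_mult_distrib
        by (simp only: right_diff_distrib diff_divide_distrib)
      also have "\<dots> = (if odd j then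
          of_nat m ^ (2 * j) * (2 * \<i> * (- 1) ^ (j div 2) * 2 ^ j) / 2 ^ (2 * j) else 0)"
        by (simp only: one_plus_minus_ii_diff_even) simp
      finally have zw: "z ^ (2 * j) - w ^ (2 * j) = \<dots>" .
      obtain d where d: "n = 2 * j + d" using \<open>2 * j \<le> n\<close> le_Suc_ex by blast
      have "n - j = j + d" using d by simp
      then have "(2::complex) ^ n * 2 ^ j / 2 ^ (2 * j) = 2 ^ (n - j)"
        by (simp add: d power_add)
      then have e: "2 ^ (n - j) = (2::complex) ^ n * 2 ^ j / 2 ^ (2 * j)" ..
      have "2 ^ n / (2 * \<i>) * (c * z ^ (2 * j) - c * w ^ (2 * j)) =
          2 ^ n / (2 * \<i>) * c * (z ^ (2 * j) - w ^ (2 * j))"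
        by (simp add: algebra_simps)
      \<comment> \<open>The powers are abstracted to variables so that only field arithmetic
        remains; at \<open>v' = 0\<close> both sides are 0 by the division convention.\<close>
      moreover have "u / (2 * \<i>) * c * (a * (2 * \<i> * b * v) / v') = c * b * (u * v / v') * a"
        for u a b v v' :: complex
        by (cases "v' = 0") (simp_all add: field_simps)
      ultimately show ?thesis
        unfolding zw e by simp
    qed
    show "{k. k \<le> n \<and> (4::int) dvd int k - 2} \<subseteq> {k. k \<le> n \<and> even k}"
      by (auto, presburger)
    show "\<forall>k\<in>{k. k \<le> n \<and> even k} - {k. k \<le> n \<and> (4::int) dvd int k - 2}.
      2 ^ n / (2 * \<i>) * (of_nat (n choose k) * of_real (bernoulli (n - k)) * z ^ k
            - of_nat (n choose k) * of_real (bernoulli (n - k)) * w ^ k) = 0"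
    proof
      fix k assume "k \<in> {k. k \<le> n \<and> even k} - {k. k \<le> n \<and> (4::int) dvd int k - 2}"
      then have k: "k \<le> n" "even k" "\<not> (4::int) dvd int k - 2" by auto
      define j where "j = k div 2"
      have "k = 2 * j" "even j" unfolding j_def using k by presburger+
      then show "2 ^ n / (2 * \<i>) * (of_nat (n choose k) * of_real (bernoulli (n - k)) * z ^ k
            - of_nat (n choose k) * of_real (bernoulli (n - k)) * w ^ k) = 0"
        using *[of j 1] k(1) by simp
    qed
    fix k assume "k \<in> {k. k \<le> n \<and> (4::int) dvd int k - 2}"
    then have k: "k \<le> n" "k mod 4 = 2" by (auto, presburger)
    \<comment> \<open>Writing \<open>k = 4 * t + 2\<close> shows that the truncated
      \<open>k - 2\<close> is exact here; the integer divisibility has already excluded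
      \<open>k = 0\<close>.\<close>
    define t where "t = k div 4"
    define j where "j = Suc (2 * t)"
    have "k = 4 * t + 2"
      unfolding t_def using k(2) by (metis mult_div_mod_eq)
    then have j: "k = 2 * j" "odd j" "(k - 2) div 4 = j div 2"
      by (simp_all add: j_def)
    have "2 * j \<le> n" using j(1) k(1) by simp
    from *[OF this] j(2) have "2 ^ n / (2 * \<i>) *
          (of_nat (n choose k) * of_real (bernoulli (n - k)) * z ^ (2 * j)
            - of_nat (n choose k) * of_real (bernoulli (n - k)) * w ^ (2 * j)) =
        of_nat (n choose k) * of_real (bernoulli (n - k)) * (- 1) ^ (j div 2) * 2 ^ (n - j)
          * of_nat m ^ (2 * j)"
      by simp
    then show "of_nat (n choose k) * (- 1) ^ ((k - 2) div 4) * 2 ^ (n - k div 2) * of_nat m ^ k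
              * complex_of_real (bernoulli (n - k)) =
          2 ^ n / (2 * \<i>) * (of_nat (n choose k) * of_real (bernoulli (n - k)) * z ^ k
            - of_nat (n choose k) * of_real (bernoulli (n - k)) * w ^ k)"
      unfolding j(3) by (simp only: j(1)) (simp add: mult_ac)
  qed simp
  also have "\<dots> = 2 ^ n / (2 * \<i>) * (E z - E w)"
    by (simp only: E_def sum_distrib_left sum_subtractf right_diff_distrib)
  also have "E z - E w = bernpoly n z - bernpoly n w + of_nat n / 2 * (z ^ (n - 1) - w ^ (n - 1))"
    unfolding E_def bernpoly_even_part[OF assms(3,2)] by (simp add: algebra_simps)
  also have "bernpoly n z - bernpoly n w = of_nat n * (\<Sum>j=1..m - 1. (z - of_nat j) ^ (n - 1))"
  proof -
    have zm: "z - of_nat m = - w" by (simp add: z_def w_def field_simps)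
    \<comment> \<open>The last term \<open>j = m\<close> is split off: its value
      \<open>- (w ^ (n - 1))\<close> cancels the correction in \<open>bernpoly_uminus\<close> for
      the endpoint \<open>- w\<close>, so the sum stops at \<open>m - 1\<close>.\<close>
    have "{1..m} = insert m {1..m - 1}" using assms by auto
    then have "(\<Sum>j=1..m. (z - of_nat j) ^ (n - 1)) =
        (- w) ^ (n - 1) + (\<Sum>j=1..m - 1. (z - of_nat j) ^ (n - 1))"
      using assms zm by simp
    moreover have "(- w) ^ (n - 1) = - (w ^ (n - 1))" using assms by simp
    ultimately have sm: "(\<Sum>j=1..m. (z - of_nat j) ^ (n - 1)) =
        (\<Sum>j=1..m - 1. (z - of_nat j) ^ (n - 1)) - w ^ (n - 1)"
      by simp
    have "n \<ge> 1" using assms by simp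
    then have "bernpoly n z = bernpoly n (- w) + of_nat n * (\<Sum>j=1..m. (z - of_nat j) ^ (n - 1))"
      using bernpoly_diff_of_nat[of n z m] unfolding zm by simp
    then show ?thesis
      unfolding sm bernpoly_uminus[OF assms(3,2)] by (simp add: right_diff_distrib)
  qed
  also have "2 ^ n / (2 * \<i>) * (of_nat n * (\<Sum>j=1..m - 1. (z - of_nat j) ^ (n - 1))
        + of_nat n / 2 * (z ^ (n - 1) - w ^ (n - 1)))
      = of_nat n / \<i> * (2 ^ (n - 1) * (\<Sum>j=1..m - 1. (z - of_nat j) ^ (n - 1)))
      + of_nat n / (2 * \<i>) * (2 ^ (n - 1) * (z ^ (n - 1) - w ^ (n - 1)))"
    (is "_ = ?R")
  proof -
    have "2 * u / (2 * \<i>) * (N * a + N / 2 * b) = N / \<i> * (u * a) + N / (2 * \<i>) * (u * b)"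
      for u N a b :: complex
      by (simp add: field_simps)
    then show ?thesis unfolding npow .
  qed
  finally have L: "?L = ?R" .
  have "2 ^ (n - 1) * (\<Sum>j=1..m - 1. (z - of_nat j) ^ (n - 1)) =
      (\<Sum>j=1..m - 1. (of_nat m - 2 * of_nat j + of_nat m * \<i>) ^ (n - 1))"
  proof -
    have "2 * (z - of_nat j) = of_nat m - 2 * of_nat j + of_nat m * \<i>" for j
      by (simp add: z_def field_simps)
    then show ?thesis by (simp only: sum_distrib_left flip: power_mult_distrib)
  qed
  also have "\<dots> = - S + M"
  proof -
    \<comment> \<open>The term at \<open>r\<close> changes sign because \<open>n - 1\<close> is odd;
      the term at \<open>m - r\<close> is already the second power in \<open>S\<close>.\<close>
    have "(of_nat m - 2 * of_nat r + of_nat m * \<i>) ^ (n - 1) +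
        (of_nat m - 2 * of_nat (m - r) + of_nat m * \<i>) ^ (n - 1) =
        - ((2 * of_nat r - of_nat m - of_nat m * \<i>) ^ (n - 1)
                - (2 * of_nat r - of_nat m + of_nat m * \<i>) ^ (n - 1))"
      if "r \<in> {1..(m - 1) div 2}" for r
    proof -
      have "odd (n - 1)" using assms by simp
      moreover have "of_nat m - 2 * of_nat r + of_nat m * \<i> =
          - (2 * of_nat r - of_nat m - of_nat m * \<i>)"
        by simp
      ultimately have e1: "(of_nat m - 2 * of_nat r + of_nat m * \<i>) ^ (n - 1) =
          - ((2 * of_nat r - of_nat m - of_nat m * \<i>) ^ (n - 1))"
        by (metis power_minus_odd)
      have "r \<le> m" using that by auto
      then have e2: "of_nat m - 2 * of_nat (m - r) + of_nat m * \<i> =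
          2 * of_nat r - of_nat m + of_nat m * \<i>"
        by (simp add: of_nat_diff)
      show ?thesis unfolding e1 e2 by simp
    qed
    then have "(\<Sum>r=1..(m - 1) div 2. (of_nat m - 2 * of_nat r + of_nat m * \<i>) ^ (n - 1) +
        (of_nat m - 2 * of_nat (m - r) + of_nat m * \<i>) ^ (n - 1)) = - S"
      unfolding S_def sum_negf[symmetric] by (intro sum.cong refl)
    \<comment> \<open>For even \<open>m\<close> the real part \<open>m - 2 * (m div 2)\<close> is 0,
      leaving a power of \<open>m\<close> times \<i>.\<close>
    moreover have "(if even m then (of_nat m - 2 * of_nat (m div 2) + of_nat m * \<i>) ^ (n - 1) else 0)
        = M"
      by (auto simp: M_def power_mult_distrib elim!: evenE)
    ultimately show ?thesis
      unfolding sum_pair_reflect[OF assms(1)] by (simp only:)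
  qed
  finally have sum: "2 ^ (n - 1) * (\<Sum>j=1..m - 1. (z - of_nat j) ^ (n - 1)) = - S + M" .
  have "2 ^ (n - 1) * (z ^ (n - 1) - w ^ (n - 1)) =
      of_nat m ^ (n - 1) * ((1 + \<i>) ^ (2 * q - 1) - (1 - \<i>) ^ (2 * q - 1))"
    unfolding z_def w_def q power_divide power_mult_distrib
    by (simp add: right_diff_distrib del: One_nat_def)
  also have "\<dots> = of_nat m ^ (n - 1) * (\<i> * (- 1) ^ ((n - 2) div 4) * 2 ^ (n div 2))"
  proof -
    have "n - 2 = 2 * (q - 1)" "n div 2 = q" using q by simp_all
    moreover have "2 * (q - 1) div 4 = (q - 1) div 2"
      using div_mult_mult1[of 2 "q - 1" 2] by simp
    ultimately have "(n - 2) div 4 = (q - 1) div 2" "n div 2 = q" by (simp_all only:)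
    then show ?thesis by (simp only: one_plus_minus_ii_diff_odd[OF q(2)])
  qed
  finally have zw: "2 ^ (n - 1) * (z ^ (n - 1) - w ^ (n - 1)) = \<dots>" .
  have "\<i> * \<i> ^ (n - 1) = (- 1) ^ (n div 2)"
    using q by (simp flip: power_Suc add: power_mult)
  \<comment> \<open>The factor \<open>1 + (- 1) ^ m\<close> encodes the case split: it is 2 when the
    middle term exists and 0 otherwise.\<close>
  then have M: "2 * \<i> * M = (1 + (- 1) ^ m) * (- 1) ^ (n div 2) * of_nat m ^ (n - 1)"
    by (auto simp: M_def)
  have "?L = of_nat n / 2 * (of_nat m ^ (n - 1) * ((- 1) ^ ((n - 2) div 4) * 2 ^ (n div 2))
      - 2 * \<i> * M + 2 * \<i> * S)"
  proof -
    have "N / \<i> * (- S + M) + N / (2 * \<i>) * (a * (\<i> * b * d)) =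
        N / 2 * (a * (b * d) - 2 * \<i> * M + 2 * \<i> * S)" for N a b d :: complex
      by (simp add: field_simps)
    then show ?thesis unfolding L sum zw .
  qed
  then show ?thesis
    unfolding M S_def by (simp add: algebra_simps)
qed

end
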